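(* Let $\mathcal{P}$ be any polyomino and let $\mathcal{P}_{K_4}$ be the graph obtained from the graph of $\mathcal{P}$ by replacing each $4$-cycle by a complete graph $K_4$ (i.e. adding both diagonals as edges). Then $\mathcal{P}_{K_4}$ is word-representable.
   Context: A polyomino is a plane figure formed by joining finitely many equal unit squares edge to edge, regarded as a graph whose vertices are the corners of its squares and whose edges are the sides of its squares. A graph $G=(V,E)$ is word-representable if there is a word $w$ over the alphabet $V$ such that for all distinct $x,y\in V$, the letters $x$ and $y$ alternate in $w$ if and only if $\{x,y\}\in E$. *)

theory Defs
  imports Main
begin

text \<open>The pair \<open>(i, j)\<close>, read as a cell, is the unit square with corners
  \<open>(i, j)\<close>, \<open>(i + 1, j)\<close>, \<open>(i, j + 1)\<close>, \<open>(i + 1, j + 1)\<close>; read as a point, it is a lattice point.\<close>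

type_synonym cell = "int \<times> int"
type_synonym point = "int \<times> int"

fun cell_corners :: "cell \<Rightarrow> point set" where
  "cell_corners (i, j) = {(i, j), (i + 1, j), (i, j + 1), (i + 1, j + 1)}"

fun cell_sides :: "cell \<Rightarrow> point set set" where
  "cell_sides (i, j) =
     {{(i, j), (i + 1, j)}, {(i, j + 1), (i + 1, j + 1)},
      {(i, j), (i, j + 1)}, {(i + 1, j), (i + 1, j + 1)}}"

definition polyomino :: "cell set \<Rightarrow> bool" where
  "polyomino P \<longleftrightarrow> finite P \<and> P \<noteq> {} \<and>
     (\<forall>c\<in>P. \<forall>d\<in>P. (c, d) \<in> {(a, b). a \<in> P \<and> b \<in> P \<and> cell_sides a \<inter> cell_sides b \<noteq> {}}\<^sup>*)"

definition polyomino_verts :: "cell set \<Rightarrow> point set" where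
  "polyomino_verts P = (\<Union>c\<in>P. cell_corners c)"

definition polyomino_edges :: "cell set \<Rightarrow> point set set" where
  "polyomino_edges P = (\<Union>c\<in>P. cell_sides c)"

definition four_cycle :: "'a set set \<Rightarrow> 'a \<Rightarrow> 'a \<Rightarrow> 'a \<Rightarrow> 'a \<Rightarrow> bool" where
  "four_cycle E a b c d \<longleftrightarrow> distinct [a, b, c, d] \<and>
     {a, b} \<in> E \<and> {b, c} \<in> E \<and> {c, d} \<in> E \<and> {d, a} \<in> E"

definition K4_edges :: "'a set set \<Rightarrow> 'a set set" where
  "K4_edges E = E \<union>
     {{x, y} | x y. x \<noteq> y \<and> (\<exists>a b c d. four_cycle E a b c d \<and> {x, y} \<subseteq> {a, b, c, d})}"

text \<open>Two letters alternate if deleting all other letters leaves a word of the form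
  \<open>xyxy\<dots>\<close> or \<open>yxyx\<dots>\<close> (of even or odd length).\<close>

definition alternate :: "'a \<Rightarrow> 'a \<Rightarrow> 'a list \<Rightarrow> bool" where
  "alternate x y w \<longleftrightarrow> distinct_adj (filter (\<lambda>z. z = x \<or> z = y) w)"

definition word_representable :: "'a set \<Rightarrow> 'a set set \<Rightarrow> bool" where
  "word_representable V E \<longleftrightarrow>
     (\<exists>w. set w \<subseteq> V \<and> (\<forall>x\<in>V. \<forall>y\<in>V. x \<noteq> y \<longrightarrow> (alternate x y w \<longleftrightarrow> {x, y} \<in> E)))"

text \<open>For finite \<open>V\<close> it makes no difference whether every vertex is required to occur
  in the word: the missing letters can be prepended, once each.\<close>

lemma alternate_missing_prefix:
  assumes "distinct m" "set m \<inter> set w = {}"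
  shows "alternate x y (m @ w) \<longleftrightarrow> alternate x y w"
  using assms
proof (induction m)
  case (Cons a m)
  let ?f = "filter (\<lambda>z. z = x \<or> z = y) (m @ w)"
  have "a \<notin> set ?f" using Cons.prems by auto
  then have "?f = [] \<or> a \<noteq> hd ?f" using hd_in_set[of ?f] by metis
  then have "alternate x y (a # m @ w) \<longleftrightarrow> alternate x y (m @ w)"
    by (auto simp: alternate_def distinct_adj_Cons simp del: filter_append)
  with Cons show ?case by simp
qed simp

lemma word_representable_iff_all_letters:
  assumes "finite V"
  shows "word_representable V E \<longleftrightarrow>
    (\<exists>w. set w = V \<and> (\<forall>x\<in>V. \<forall>y\<in>V. x \<noteq> y \<longrightarrow> (alternate x y w \<longleftrightarrow> {x, y} \<in> E)))"
proof
  assume "word_representable V E"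
  then obtain w where w: "set w \<subseteq> V"
    "\<forall>x\<in>V. \<forall>y\<in>V. x \<noteq> y \<longrightarrow> (alternate x y w \<longleftrightarrow> {x, y} \<in> E)"
    unfolding word_representable_def by blast
  obtain m where m: "set m = V - set w" "distinct m"
    using finite_distinct_list[of "V - set w"] assms by auto
  have "set (m @ w) = V" using m(1) w(1) by auto
  moreover have "alternate x y (m @ w) \<longleftrightarrow> alternate x y w" for x y
    using alternate_missing_prefix[OF m(2)] m(1) by blast
  ultimately show "\<exists>w. set w = V \<and> (\<forall>x\<in>V. \<forall>y\<in>V. x \<noteq> y \<longrightarrow> (alternate x y w \<longleftrightarrow> {x, y} \<in> E))"
    using w(2) by blast
qed (auto simp: word_representable_def)

end

theory Submission
  imports Defs
begin

text \<open>Colour the lattice points cyclically by parity, \<open>(0,0)\<close>, \<open>(0,1)\<close>, \<open>(1,1)\<close>, \<open>(1,0)\<close>, and orient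
  every edge towards the larger colour. Sides of squares join cyclically consecutive colours and
  diagonals do not, so a directed path through all four colours whose ends are adjacent is a
  4-cycle of the polyomino, hence a clique: the orientation is semi-transitive.

  A semi-transitive orientation yields a word as follows. Let every vertex \<open>x\<close> occur at the times
  \<open>f x\<close> and \<open>f x + K\<close>. If \<open>0 < f y - f x < K\<close> for every arc \<open>x \<rightarrow> y\<close>, then all edges alternate, as
  \<open>xyxy\<close>. For each non-edge such an \<open>f\<close> (or two of them) can be chosen so that its ends do not
  alternate; the concatenation of all these words represents the graph.\<close>

section \<open>Words from occurrence times\<close>

definition timed_word :: "('a \<Rightarrow> nat) \<Rightarrow> nat \<Rightarrow> 'a list \<Rightarrow> 'a list" where
  "timed_word f K vs =
     map snd (sort_key fst (map (\<lambda>z. (f z, z)) vs @ map (\<lambda>z. (f z + K, z)) vs))"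

lemma set_timed_word: "set (timed_word f K vs) = set vs"
  by (auto simp: timed_word_def image_Un image_image)

lemma filter_pair_distinct:
  assumes "distinct vs" "x \<in> set vs" "y \<in> set vs" "x \<noteq> y"
  shows "filter (\<lambda>z. z = x \<or> z = y) vs = [x, y] \<or> filter (\<lambda>z. z = x \<or> z = y) vs = [y, x]"
proof -
  let ?l = "filter (\<lambda>z. z = x \<or> z = y) vs"
  have d: "distinct ?l" and s: "set ?l = {x, y}" using assms by auto
  then have "length ?l = 2" using distinct_card[OF d] assms(4) by simp
  then obtain a b where "?l = [a, b]"
    by (metis (no_types, lifting) One_nat_def Suc_1 length_0_conv length_Suc_conv)
  then show ?thesis using d s by (auto simp: doubleton_eq_iff)
qed

text \<open>Filtering commutes with the stable sort, so restricting a timed word to two letters only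
  leaves four entries to sort.\<close>

lemma filter_timed_word:
  "filter P (timed_word f K vs) =
     map snd (sort_key fst (map (\<lambda>z. (f z, z)) (filter P vs) @ map (\<lambda>z. (f z + K, z)) (filter P vs)))"
  by (simp add: timed_word_def filter_map filter_sort comp_def)

lemma timed_word_alternating:
  assumes "distinct vs" "x \<in> set vs" "y \<in> set vs" "f x < f y" "f y < f x + K"
  shows "filter (\<lambda>z. z = x \<or> z = y) (timed_word f K vs) = [x, y, x, y]"
proof -
  have "x \<noteq> y" using assms by auto
  from filter_pair_distinct[OF assms(1-3) this] show ?thesis
    unfolding filter_timed_word using assms by auto
qed

lemma timed_word_separated:
  assumes "distinct vs" "x \<in> set vs" "y \<in> set vs" "f x + K < f y" "0 < K"
  shows "filter (\<lambda>z. z = x \<or> z = y) (timed_word f K vs) = [x, x, y, y]"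
proof -
  have "x \<noteq> y" using assms by auto
  from filter_pair_distinct[OF assms(1-3) this] show ?thesis
    unfolding filter_timed_word using assms by auto
qed

section \<open>Semi-transitive orientations\<close>

text \<open>The last condition says that an arc \<open>(x, y)\<close> turns every directed path from \<open>x\<close> to \<open>y\<close>
  into a transitive tournament, i.e. that there are no shortcuts.\<close>

definition semi_transitive :: "('a \<times> 'a) set \<Rightarrow> bool" where
  "semi_transitive A \<longleftrightarrow> acyclic A \<and>
     (\<forall>x u v y. (x, y) \<in> A \<longrightarrow> (x, u) \<in> A\<^sup>* \<longrightarrow> (u, v) \<in> A\<^sup>+ \<longrightarrow> (v, y) \<in> A\<^sup>* \<longrightarrow> (u, v) \<in> A)"

text \<open>Plain alternation is not closed under concatenation: \<open>xyx\<close> followed by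
  itself contains \<open>xx\<close>. Demanding a power of \<open>xy\<close> for every arc
  is.\<close>

definition forward_word :: "'a set \<Rightarrow> ('a \<times> 'a) set \<Rightarrow> 'a list \<Rightarrow> bool" where
  "forward_word V A w \<longleftrightarrow> set w \<subseteq> V \<and>
     (\<forall>(x, y)\<in>A. \<exists>k. filter (\<lambda>z. z = x \<or> z = y) w = concat (replicate k [x, y]))"

lemma forward_word_append:
  assumes "forward_word V A w" "forward_word V A w'"
  shows "forward_word V A (w @ w')"
  unfolding forward_word_def
proof (intro conjI ballI, goal_cases)
  case 1
  then show ?case using assms by (simp add: forward_word_def)
next
  case (2 p)
  obtain x y where p: "p = (x, y)" by fastforce
  obtain k k' where "filter (\<lambda>z. z = x \<or> z = y) w = concat (replicate k [x, y])"
    "filter (\<lambda>z. z = x \<or> z = y) w' = concat (replicate k' [x, y])"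
    using assms 2 p unfolding forward_word_def by blast
  then have "filter (\<lambda>z. z = x \<or> z = y) (w @ w') = concat (replicate (k + k') [x, y])"
    by (simp add: replicate_add)
  then show ?case using p by blast
qed

lemma forward_word_timed_word:
  assumes "distinct vs" "set vs = V" "A \<subseteq> V \<times> V"
    and "\<And>x y. (x, y) \<in> A \<Longrightarrow> f x < f y \<and> f y < f x + K"
  shows "forward_word V A (timed_word f K vs)"
  unfolding forward_word_def
proof (intro conjI ballI, goal_cases)
  case 1
  then show ?case using assms by (simp add: set_timed_word)
next
  case (2 p)
  obtain x y where p: "p = (x, y)" by fastforce
  have "filter (\<lambda>z. z = x \<or> z = y) (timed_word f K vs) = concat (replicate 2 [x, y])"
    using timed_word_alternating[of vs x y f K] assms 2 p by (auto simp: numeral_2_eq_2)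
  then show ?case using p by blast
qed

lemma distinct_adj_concat_replicate:
  assumes "x \<noteq> y"
  shows "distinct_adj (concat (replicate k [x, y]))"
proof (induction k)
  case (Suc k)
  then show ?case using assms by (cases k) (auto simp: distinct_adj_Cons)
qed simp

lemma alternate_commute: "alternate x y w \<longleftrightarrow> alternate y x w"
  by (simp add: alternate_def disj_commute)

text \<open>Used contrapositively: one factor in which two letters fail to alternate spoils every
  word containing it, so a separated non-edge stays separated.\<close>

lemma alternate_appendD:
  assumes "alternate x y (w @ w')"
  shows "alternate x y w" "alternate x y w'"
  using assms by (auto simp: alternate_def distinct_adj_append_iff)

text \<open>The rank counts proper ancestors. It grows along an arc because, by acyclicity, the tail
  is an ancestor of the head but not of itself.\<close>

lemma acyclic_finite_rank:
  assumes "finite V" "A \<subseteq> V \<times> V" "acyclic A"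
  obtains c :: "'a \<Rightarrow> nat" and n where
    "\<And>x y. (x, y) \<in> A \<Longrightarrow> c x < c y" "\<And>x. c x < n"
proof
  have sub: "{z. (z, x) \<in> A\<^sup>+} \<subseteq> V" for x
    by (auto dest!: trancl_subset_Sigma[OF assms(2), THEN subsetD])
  have fin: "finite {z. (z, x) \<in> A\<^sup>+}" for x
    using finite_subset[OF sub assms(1)] .
  show "card {z. (z, x) \<in> A\<^sup>+} < card {z. (z, y) \<in> A\<^sup>+}" if "(x, y) \<in> A" for x y
  proof (rule psubset_card_mono[OF fin])
    have "(x, x) \<notin> A\<^sup>+" using assms(3) by (simp add: acyclic_def)
    then show "{z. (z, x) \<in> A\<^sup>+} \<subset> {z. (z, y) \<in> A\<^sup>+}" using that by auto
  qed
  show "card {z. (z, x) \<in> A\<^sup>+} < Suc (card V)" for x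
    using card_mono[OF assms(1) sub] by (simp add: less_Suc_eq_le)
qed

text \<open>If \<open>v\<close> is reachable from \<open>u\<close>, everything reachable from \<open>v\<close> is delayed by more than \<open>K\<close>; this
  forces a shorter delay on the in-neighbours of the delayed vertices and on what is reachable from
  those. The absence of shortcuts guarantees that \<open>u\<close> itself is not delayed.\<close>

lemma separating_word_reachable:
  assumes "finite V" "A \<subseteq> V \<times> V" "semi_transitive A"
    and "u \<in> V" "v \<in> V" "(u, v) \<in> A\<^sup>+" "(u, v) \<notin> A"
  shows "\<exists>w. forward_word V A w \<and> \<not> alternate u v w"
proof -
  have ac: "acyclic A" using assms(3) by (simp add: semi_transitive_def)
  obtain c :: "'a \<Rightarrow> nat" and n where c: "\<And>x y. (x, y) \<in> A \<Longrightarrow> c x < c y" "\<And>x. c x < n"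
    using acyclic_finite_rank[OF assms(1,2) ac] by blast
  obtain vs where vs: "distinct vs" "set vs = V"
    using finite_distinct_list[OF assms(1)] by blast
  define D where "D = {y. (v, y) \<in> A\<^sup>*}"
  define R where "R = {z. \<exists>x y. (x, z) \<in> A\<^sup>* \<and> (x, y) \<in> A \<and> y \<in> D}"
  \<comment> \<open>Three layers of height \<open>n\<close> start at 0, \<open>2 * n\<close> and
    \<open>5 * n\<close>. Every arc stays in its layer or climbs to the next one, gaining less than
    \<open>4 * n\<close>; from \<open>u\<close> at the bottom to \<open>v\<close> at the top the
    gain exceeds \<open>4 * n\<close>.\<close>
  define f where "f z = (if z \<in> D then 5 * n + c z else if z \<in> R then 2 * n + c z else c z)" for z
  \<comment> \<open>Otherwise some arc \<open>(x, y)\<close> would span a path from \<open>x\<close>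
    through \<open>u\<close> and \<open>v\<close> to \<open>y\<close>, which makes
    \<open>(u, v)\<close> an arc.\<close>
  have "u \<notin> R"
    using assms(3,6,7) unfolding semi_transitive_def R_def D_def by blast
  moreover have "u \<notin> D"
    using assms(6) ac by (auto simp: D_def acyclic_def dest: trancl_rtrancl_trancl)
  moreover have "v \<in> D" by (simp add: D_def)
  ultimately have "f u + 4 * n < f v" "0 < n"
    using c(2)[of u] by (auto simp: f_def)
  then have "\<not> alternate u v (timed_word f (4 * n) vs)"
    using timed_word_separated[of vs u v f "4 * n"] vs assms(4,5) by (simp add: alternate_def)
  moreover have "f x < f y \<and> f y < f x + 4 * n" if "(x, y) \<in> A" for x y
  proof -
    have "x \<in> D \<Longrightarrow> y \<in> D" "x \<in> R \<Longrightarrow> y \<in> R" "y \<in> D \<Longrightarrow> x \<in> R"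
      using that by (auto simp: D_def R_def intro: rtrancl_into_rtrancl)
    then show ?thesis using c(1)[OF that] c(2)[of x] c(2)[of y] by (auto simp: f_def)
  qed
  then have "forward_word V A (timed_word f (4 * n) vs)"
    using forward_word_timed_word vs assms(2) by blast
  ultimately show ?thesis by blast
qed

text \<open>Delay everything reachable from \<open>u\<close> by a full range \<open>n\<close> of the
  rank. This set is closed under arcs, so arcs still point forward, yet \<open>u\<close> now comes
  after every vertex outside the set.\<close>

lemma reversing_times:
  assumes "finite V" "A \<subseteq> V \<times> V" "acyclic A"
  obtains f :: "'a \<Rightarrow> 'a \<Rightarrow> nat" and K where
    "\<And>u x y. (x, y) \<in> A \<Longrightarrow> f u x < f u y \<and> f u y < f u x + K"
    "\<And>u v. (u, v) \<notin> A\<^sup>* \<Longrightarrow> f u v < f u u \<and> f u u < f u v + K"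
proof -
  obtain c :: "'a \<Rightarrow> nat" and n where c: "\<And>x y. (x, y) \<in> A \<Longrightarrow> c x < c y" "\<And>x. c x < n"
    using acyclic_finite_rank[OF assms] by blast
  define f where "f u z = (if (u, z) \<in> A\<^sup>* then n + c z else c z)" for u z
  show ?thesis
  proof
    show "f u x < f u y \<and> f u y < f u x + 2 * n" if "(x, y) \<in> A" for u x y
      using c(1)[OF that] c(2)[of x] c(2)[of y] that
      by (auto simp: f_def intro: rtrancl_into_rtrancl)
    show "f u v < f u u \<and> f u u < f u v + 2 * n" if "(u, v) \<notin> A\<^sup>*" for u v
      using c(2)[of u] c(2)[of v] that by (auto simp: f_def)
  qed
qed

text \<open>Either order of \<open>u\<close> and \<open>v\<close> can be realised by suitable times.
  Each of the two words alternates on its own; the repetition \<open>uu\<close> arises at the seam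
  of \<open>vuvu\<close> and \<open>uvuv\<close>.\<close>

lemma separating_word_unreachable:
  assumes "finite V" "A \<subseteq> V \<times> V" "acyclic A"
    and "u \<in> V" "v \<in> V" "(u, v) \<notin> A\<^sup>*" "(v, u) \<notin> A\<^sup>*"
  shows "\<exists>w. forward_word V A w \<and> \<not> alternate u v w"
proof -
  obtain f :: "'a \<Rightarrow> 'a \<Rightarrow> nat" and K where
    f: "\<And>u x y. (x, y) \<in> A \<Longrightarrow> f u x < f u y \<and> f u y < f u x + K"
       "\<And>u v. (u, v) \<notin> A\<^sup>* \<Longrightarrow> f u v < f u u \<and> f u u < f u v + K"
    using reversing_times[OF assms(1-3)] by blast
  obtain vs where vs: "distinct vs" "set vs = V"
    using finite_distinct_list[OF assms(1)] by blast
  let ?w = "timed_word (f u) K vs @ timed_word (f v) K vs"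
  have "forward_word V A ?w"
    using forward_word_timed_word[OF vs assms(2)] f(1) by (intro forward_word_append) blast+
  moreover have "filter (\<lambda>z. z = v \<or> z = u) (timed_word (f u) K vs) = [v, u, v, u]"
    using timed_word_alternating[of vs v u "f u" K] vs assms f(2) by blast
  moreover have "filter (\<lambda>z. z = u \<or> z = v) (timed_word (f v) K vs) = [u, v, u, v]"
    using timed_word_alternating[of vs u v "f v" K] vs assms f(2) by blast
  ultimately show ?thesis
    by (intro exI[of _ ?w]) (simp add: alternate_def disj_commute)
qed

lemma separating_word:
  assumes "finite V" "A \<subseteq> V \<times> V" "semi_transitive A"
    and "u \<in> V" "v \<in> V" "u \<noteq> v" "(u, v) \<notin> A" "(v, u) \<notin> A"
  shows "\<exists>w. forward_word V A w \<and> \<not> alternate u v w"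
proof -
  have "acyclic A" using assms(3) by (simp add: semi_transitive_def)
  consider "(u, v) \<in> A\<^sup>+" | "(v, u) \<in> A\<^sup>+" | "(u, v) \<notin> A\<^sup>*" "(v, u) \<notin> A\<^sup>*"
    using assms(6) by (metis rtranclD)
  then show ?thesis
  proof cases
    case 1
    then show ?thesis using separating_word_reachable assms by metis
  next
    case 2
    then show ?thesis using separating_word_reachable assms alternate_commute by metis
  next
    case 3
    then show ?thesis using separating_word_unreachable assms \<open>acyclic A\<close> by metis
  qed
qed

theorem semi_transitive_word_representable:
  assumes "finite V" "A \<subseteq> V \<times> V" "semi_transitive A"
    and E: "\<And>x y. x \<in> V \<Longrightarrow> y \<in> V \<Longrightarrow> x \<noteq> y \<Longrightarrow> {x, y} \<in> E \<longleftrightarrow> (x, y) \<in> A \<or> (y, x) \<in> A"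
  shows "word_representable V E"
proof -
  have words: "\<exists>w. forward_word V A w \<and> (\<forall>(u, v)\<in>S. \<not> alternate u v w)"
    if "finite S" "S \<subseteq> {(u, v). u \<in> V \<and> v \<in> V \<and> u \<noteq> v \<and> (u, v) \<notin> A \<and> (v, u) \<notin> A}" for S
    using that
  proof (induction S)
    case empty
    have "forward_word V A []" by (auto simp: forward_word_def intro: exI[of _ 0])
    then show ?case by auto
  next
    case (insert p S)
    obtain u v where p: "p = (u, v)" by fastforce
    obtain w where w: "forward_word V A w" "\<forall>(u, v)\<in>S. \<not> alternate u v w"
      using insert by auto
    obtain w' where w': "forward_word V A w'" "\<not> alternate u v w'"
      using separating_word[OF assms(1-3), of u v] insert.prems p by auto
    have "\<forall>(u, v)\<in>insert p S. \<not> alternate u v (w @ w')"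
      using w(2) w'(2) p by (auto dest: alternate_appendD)
    then show ?case using forward_word_append[OF w(1) w'(1)] by blast
  qed
  have "finite {(u, v). u \<in> V \<and> v \<in> V \<and> u \<noteq> v \<and> (u, v) \<notin> A \<and> (v, u) \<notin> A}"
    by (rule finite_subset[of _ "V \<times> V"]) (use assms(1) in auto)
  from words[OF this order_refl] obtain w where w: "forward_word V A w"
    "\<And>u v. u \<in> V \<Longrightarrow> v \<in> V \<Longrightarrow> u \<noteq> v \<Longrightarrow> (u, v) \<notin> A \<Longrightarrow> (v, u) \<notin> A \<Longrightarrow> \<not> alternate u v w"
    by blast
  have "alternate x y w" if "(x, y) \<in> A" for x y
  proof -
    have "x \<noteq> y" using that assms(3) by (auto simp: semi_transitive_def acyclic_def)
    then show ?thesis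
      using w(1) that distinct_adj_concat_replicate[of x y]
      unfolding forward_word_def alternate_def by fastforce
  qed
  then have "alternate x y w \<longleftrightarrow> {x, y} \<in> E" if "x \<in> V" "y \<in> V" "x \<noteq> y" for x y
    using w(2) E that alternate_commute by metis
  moreover have "set w \<subseteq> V" using w(1) by (simp add: forward_word_def)
  ultimately show ?thesis unfolding word_representable_def by blast
qed

section \<open>Graphs of polyominoes\<close>

text \<open>Adjacency in the whole square grid, which contains the graph of every polyomino and
  already determines the shape of 4-cycles.\<close>

definition grid_adjacent :: "point \<Rightarrow> point \<Rightarrow> bool" where
  "grid_adjacent p q \<longleftrightarrow> \<bar>fst p - fst q\<bar> + \<bar>snd p - snd q\<bar> = 1"

fun point_colour :: "point \<Rightarrow> nat" where
  "point_colour (i, j) = (if even i then (if even j then 0 else 1) else (if even j then 3 else 2))"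

lemma point_colour_less: "point_colour p < 4"
  by (cases p) auto

lemma polyomino_edges_grid_adjacent:
  assumes "{p, q} \<in> polyomino_edges P"
  shows "grid_adjacent p q"
  using assms unfolding polyomino_edges_def by (force simp: grid_adjacent_def doubleton_eq_iff)

lemma grid_adjacent_iff:
  "grid_adjacent (i, j) q \<longleftrightarrow> q \<in> {(i + 1, j), (i - 1, j), (i, j + 1), (i, j - 1)}"
proof -
  have "\<bar>a\<bar> + \<bar>b\<bar> = 1 \<longleftrightarrow> a = 0 \<and> (b = 1 \<or> b = - 1) \<or> b = 0 \<and> (a = 1 \<or> a = - 1)" for a b :: int
    by arith
  then show ?thesis by (cases q) (auto simp: grid_adjacent_def)
qed

lemma grid_adjacent_colour:
  assumes "grid_adjacent p q"
  shows "odd (point_colour p + point_colour q)"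
  using assms by (cases p) (auto simp: grid_adjacent_iff)

text \<open>Both \<open>b\<close> and \<open>d\<close> are common neighbours of \<open>a\<close> and
  \<open>c\<close>. Points at distance two on a grid line have only their midpoint in common, which
  would force \<open>b = d\<close>.\<close>

lemma grid_four_cycle_opposite:
  assumes "grid_adjacent a b" "grid_adjacent b c" "grid_adjacent c d" "grid_adjacent d a"
    and "a \<noteq> c" "b \<noteq> d"
  shows "\<bar>fst a - fst c\<bar> = 1 \<and> \<bar>snd a - snd c\<bar> = 1"
proof -
  obtain i j k l where ac: "a = (i, j)" "c = (k, l)" by fastforce
  have "grid_adjacent a d" using assms(4) by (simp add: grid_adjacent_def)
  then have d: "d \<in> {(i + 1, j), (i - 1, j), (i, j + 1), (i, j - 1)}"
    and d': "d \<in> {(k + 1, l), (k - 1, l), (k, l + 1), (k, l - 1)}"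
    using assms(3) by (simp_all only: ac grid_adjacent_iff)
  have "grid_adjacent c b" using assms(2) by (simp add: grid_adjacent_def)
  then have b: "b \<in> {(i + 1, j), (i - 1, j), (i, j + 1), (i, j - 1)}"
    and b': "b \<in> {(k + 1, l), (k - 1, l), (k, l + 1), (k, l - 1)}"
    using assms(1) by (simp_all only: ac grid_adjacent_iff)
  \<comment> \<open>The second alternative says that \<open>b\<close> is the midpoint of
    \<open>a\<close> and \<open>c\<close>.\<close>
  from b b' have "\<bar>i - k\<bar> = 1 \<and> \<bar>j - l\<bar> = 1 \<or>
      2 * fst b = i + k \<and> 2 * snd b = j + l"
    using assms(5) by (auto simp: ac)
  moreover from d d' have "\<bar>i - k\<bar> = 1 \<and> \<bar>j - l\<bar> = 1 \<or>
      2 * fst d = i + k \<and> 2 * snd d = j + l"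
    using assms(5) by (auto simp: ac)
  ultimately show ?thesis using assms(6) by (auto simp: ac prod_eq_iff)
qed

lemma opposite_colour:
  assumes "\<bar>fst p - fst q\<bar> = 1" "\<bar>snd p - snd q\<bar> = 1"
  shows "even (point_colour p + point_colour q)" "point_colour p \<noteq> point_colour q"
proof -
  obtain i j k l where pq: "p = (i, j)" "q = (k, l)" by fastforce
  then have "(k = i + 1 \<or> k = i - 1)" "(l = j + 1 \<or> l = j - 1)" using assms by auto
  then show "even (point_colour p + point_colour q)" "point_colour p \<noteq> point_colour q"
    by (auto simp: pq)
qed

text \<open>Two vertices of a 4-cycle that do not form an edge are opposite in it, hence diagonal
  neighbours in the grid. Sides change the parity of the colour; diagonals keep it but change the
  colour.\<close>

lemma K4_edge_cases:
  assumes "{x, y} \<in> K4_edges (polyomino_edges P)"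
  obtains "{x, y} \<in> polyomino_edges P" "odd (point_colour x + point_colour y)"
  | "even (point_colour x + point_colour y)" "point_colour x \<noteq> point_colour y"
proof (cases "{x, y} \<in> polyomino_edges P")
  case True
  then show ?thesis using that polyomino_edges_grid_adjacent grid_adjacent_colour by blast
next
  case False
  then obtain a b c d where cyc: "four_cycle (polyomino_edges P) a b c d"
    and xy: "x \<noteq> y" "x \<in> {a, b, c, d}" "y \<in> {a, b, c, d}"
    using assms by (auto simp: K4_edges_def doubleton_eq_iff)
  from cyc have "\<bar>fst a - fst c\<bar> = 1 \<and> \<bar>snd a - snd c\<bar> = 1"
    by (intro grid_four_cycle_opposite[of a b c d])
      (auto simp: four_cycle_def intro: polyomino_edges_grid_adjacent)
  moreover from cyc have "\<bar>fst b - fst d\<bar> = 1 \<and> \<bar>snd b - snd d\<bar> = 1"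
    by (intro grid_four_cycle_opposite[of b c d a])
      (auto simp: four_cycle_def intro: polyomino_edges_grid_adjacent)
  moreover have "{x, y} = {a, c} \<or> {x, y} = {b, d}"
    using xy False cyc by (auto simp: four_cycle_def insert_commute)
  ultimately have "\<bar>fst x - fst y\<bar> = 1 \<and> \<bar>snd x - snd y\<bar> = 1"
    by (auto simp: doubleton_eq_iff)
  then show ?thesis using that(2) opposite_colour by blast
qed

definition colour_arcs :: "cell set \<Rightarrow> (point \<times> point) set" where
  "colour_arcs P = {(x, y). x \<in> polyomino_verts P \<and> y \<in> polyomino_verts P \<and>
     {x, y} \<in> K4_edges (polyomino_edges P) \<and> point_colour x < point_colour y}"

lemma colour_arcs_trancl_less:
  assumes "(x, y) \<in> (colour_arcs P)\<^sup>+"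
  shows "point_colour x < point_colour y"
  using assms by induction (auto simp: colour_arcs_def)

text \<open>Colours increase strictly along arcs, so there is no room for an intermediate
  vertex.\<close>

lemma colour_arcs_trancl_consecutive:
  assumes "(x, y) \<in> (colour_arcs P)\<^sup>+" "point_colour y \<le> Suc (point_colour x)"
  shows "(x, y) \<in> colour_arcs P"
  using assms(1)
proof (cases rule: tranclE)
  case (step z)
  then have "point_colour x < point_colour z" "point_colour z < point_colour y"
    using colour_arcs_trancl_less by (blast, blast)
  then show ?thesis using assms(2) by simp
qed

lemma colour_arc_side:
  assumes "(x, y) \<in> colour_arcs P" "odd (point_colour x + point_colour y)"
  shows "{x, y} \<in> polyomino_edges P"
  using assms by (auto simp: colour_arcs_def elim: K4_edge_cases)

text \<open>The four vertices must have colours 0, 1, 2, 3, so each path is a single arc. All colour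
  differences involved are odd, so these arcs and \<open>(x, y)\<close> are sides and close up to a
  4-cycle, whose chords are then edges.\<close>

lemma four_path_clique:
  assumes "(x, a) \<in> (colour_arcs P)\<^sup>+" "(a, b) \<in> (colour_arcs P)\<^sup>+" "(b, y) \<in> (colour_arcs P)\<^sup>+"
    and "(x, y) \<in> colour_arcs P"
  shows "(x, b) \<in> colour_arcs P" "(a, y) \<in> colour_arcs P"
proof -
  have less: "point_colour x < point_colour a" "point_colour a < point_colour b"
      "point_colour b < point_colour y"
    using assms(1-3) colour_arcs_trancl_less by blast+
  then have col: "point_colour x = 0" "point_colour a = 1" "point_colour b = 2" "point_colour y = 3"
    using point_colour_less[of y] by linarith+
  have arcs: "(x, a) \<in> colour_arcs P" "(a, b) \<in> colour_arcs P" "(b, y) \<in> colour_arcs P"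
    using assms(1-3) col by (auto intro!: colour_arcs_trancl_consecutive)
  have "{x, a} \<in> polyomino_edges P" "{a, b} \<in> polyomino_edges P" "{b, y} \<in> polyomino_edges P"
      "{x, y} \<in> polyomino_edges P"
    using arcs assms(4) col by (auto intro!: colour_arc_side)
  moreover have "distinct [x, a, b, y]" using col by auto
  ultimately have cyc: "four_cycle (polyomino_edges P) x a b y"
    by (simp add: four_cycle_def insert_commute)
  have "{p, q} \<in> K4_edges (polyomino_edges P)"
    if "p \<noteq> q" "p \<in> {x, a, b, y}" "q \<in> {x, a, b, y}" for p q
    using cyc that unfolding K4_edges_def by blast
  then have "{x, b} \<in> K4_edges (polyomino_edges P)" "{a, y} \<in> K4_edges (polyomino_edges P)"
    using col by (metis insertCI zero_neq_numeral, metis insertCI numeral_eq_one_iff semiring_norm(86))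
  then show "(x, b) \<in> colour_arcs P" "(a, y) \<in> colour_arcs P"
    using arcs col by (auto simp: colour_arcs_def)
qed

lemma semi_transitive_colour_arcs: "semi_transitive (colour_arcs P)"
  unfolding semi_transitive_def
proof (intro conjI allI impI)
  show "acyclic (colour_arcs P)"
    using colour_arcs_trancl_less by (fastforce simp: acyclic_def)
next
  fix x u v y
  let ?A = "colour_arcs P"
  assume xy: "(x, y) \<in> ?A" and xu: "(x, u) \<in> ?A\<^sup>*" and uv: "(u, v) \<in> ?A\<^sup>+" and vy: "(v, y) \<in> ?A\<^sup>*"
  show "(u, v) \<in> ?A"
  proof (rule ccontr)
    assume non: "(u, v) \<notin> ?A"
    then obtain w where w: "(u, w) \<in> ?A\<^sup>+" "(w, v) \<in> ?A\<^sup>+"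
      using uv by (metis tranclE r_into_trancl)
    \<comment> \<open>If exactly one outer path is nontrivial, \<open>w\<close> completes a
      four-vertex path and the clique lemma applies; if both are, five increasing colours would be
      needed.\<close>
    consider "x = u" "v = y" | "x = u" "(v, y) \<in> ?A\<^sup>+" | "(x, u) \<in> ?A\<^sup>+" "v = y"
      | "(x, u) \<in> ?A\<^sup>+" "(v, y) \<in> ?A\<^sup>+"
      using xu vy by (metis rtranclD)
    then show False
    proof cases
      case 1
      then show ?thesis using xy non by simp
    next
      case 2
      then show ?thesis using four_path_clique(1) w xy non by blast
    next
      case 3
      then show ?thesis using four_path_clique(2) w xy non by blast
    next
      case 4
      then have "point_colour x < point_colour u" "point_colour u < point_colour w"
          "point_colour w < point_colour v" "point_colour v < point_colour y"
        using w colour_arcs_trancl_less by blast+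
      then show ?thesis using point_colour_less[of y] by linarith
    qed
  qed
qed

theorem theorem8:
  fixes P :: "cell set"
  assumes "polyomino P"
  shows "word_representable (polyomino_verts P) (K4_edges (polyomino_edges P))"
proof (rule semi_transitive_word_representable)
  have "finite (cell_corners c)" for c by (cases c) simp
  then show "finite (polyomino_verts P)"
    using assms by (simp add: polyomino_def polyomino_verts_def)
  show "colour_arcs P \<subseteq> polyomino_verts P \<times> polyomino_verts P"
    by (auto simp: colour_arcs_def)
  show "semi_transitive (colour_arcs P)" by (rule semi_transitive_colour_arcs)
next
  fix x y
  assume V: "x \<in> polyomino_verts P" "y \<in> polyomino_verts P"
  \<comment> \<open>No edge is monochromatic, so each edge receives an orientation.\<close>
  have "point_colour x \<noteq> point_colour y" if "{x, y} \<in> K4_edges (polyomino_edges P)"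
    using that by (cases rule: K4_edge_cases) auto
  then show "{x, y} \<in> K4_edges (polyomino_edges P) \<longleftrightarrow>
      (x, y) \<in> colour_arcs P \<or> (y, x) \<in> colour_arcs P"
    using V by (auto simp: colour_arcs_def insert_commute)
qed

end
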